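(* For every $n\geq1$, $\mathrm{NID}\notin\Sigma_n$ and $\mathrm{NID}\notin\Pi_n$. Equivalently, for every computable $f:\{0,1\}^*\times\{0,1\}^*\times\omega\to\mathbb{Q}$ with $\lim_{s\to\infty}f(x,y,s)=\mathrm{NID}(x,y)$ for all $x,y$, the number of oscillations (changes between nondecreasing and nonincreasing phases) of $s\mapsto f(x,y,s)$ is not bounded by any constant uniformly in $(x,y)$.
   Context: Fix a universal prefix-free machine $U$. $K$ denotes prefix-free Kolmogorov complexity and $K(x\mid y)$ conditional prefix-free complexity. For binary strings $x,y$ let $E(x,y)=\max\{K(x\mid y),K(y\mid x)\}$ and $\mathrm{NID}(x,y)=\dfrac{E(x,y)}{\max\{K(x),K(y)\}}$, a rational-valued limit-computable function. The oscillation classes: an approximation of $F$ is a computable $f$ with $\lim_{s\to\infty}f(z,s)=F(z)$ for all $z$; $F\in\Sigma_1$ if it has an approximation nondecreasing in $s$; $F\in\Pi_1$ if it has one nonincreasing in $s$; $F\in\Sigma_{n+1}$ if it has a computable approximation $f$ such that for every $z$ there is $s_z$ with $f(z,t)$ nondecreasing for $t<s_z$ and $(f(z,t))_{t\geq s_z}$ a $\Pi_n$-approximation; $F\in\Pi_{n+1}$ likewise with nonincreasing for $t<s_z$ and $(f(z,t))_{t\geq s_z}$ a $\Sigma_n$-approximation. *)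

theory Defs
  imports Complex_Main "HOL-Library.Sublist" "HOL-Library.Nat_Bijection"
begin

datatype recf = Zr | Sc | Proj nat | Comp recf "recf list" | Prim recf recf | Mn recf

inductive eval :: "recf \<Rightarrow> nat list \<Rightarrow> nat \<Rightarrow> bool" where
  ev_Z: "eval Zr xs 0"
| ev_S: "eval Sc xs (Suc (if xs = [] then 0 else hd xs))"
| ev_Proj: "eval (Proj i) xs (if i < length xs then xs ! i else 0)"
| ev_Comp: "length rs = length gs \<Longrightarrow> (\<forall>i<length gs. eval (gs ! i) xs (rs ! i))
             \<Longrightarrow> eval f rs r \<Longrightarrow> eval (Comp f gs) xs r"
| ev_Prim0: "eval f xs r \<Longrightarrow> eval (Prim f g) (0 # xs) r"
| ev_PrimS: "eval (Prim f g) (n # xs) r' \<Longrightarrow> eval g (r' # n # xs) r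
             \<Longrightarrow> eval (Prim f g) (Suc n # xs) r"
| ev_PrimNil: "eval f [] r \<Longrightarrow> eval (Prim f g) [] r"
| ev_Mn: "eval f (n # xs) 0 \<Longrightarrow> (\<forall>m<n. \<exists>k. k > 0 \<and> eval f (m # xs) k)
             \<Longrightarrow> eval (Mn f) xs n"

text \<open>Bijective encoding of binary strings (lists of bools) as natural numbers.\<close>
fun bl_enc :: "bool list \<Rightarrow> nat" where
  "bl_enc [] = 0"
| "bl_enc (b # bs) = 2 * bl_enc bs + (if b then 2 else 1)"

definition rat_enc :: "rat \<Rightarrow> nat" where
  "rat_enc q = prod_encode (int_encode (fst (quotient_of q)), int_encode (snd (quotient_of q)))"

text \<open>A (conditional) machine maps a program p and a condition y to an optional output.\<close>
type_synonym machine = "bool list \<Rightarrow> bool list \<Rightarrow> bool list option"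

definition partial_computable_machine :: "machine \<Rightarrow> bool" where
  "partial_computable_machine M \<longleftrightarrow>
     (\<exists>c. \<forall>p y r. eval c [bl_enc p, bl_enc y] r \<longleftrightarrow> (\<exists>z. M p y = Some z \<and> r = bl_enc z))"

definition prefix_free_machine :: "machine \<Rightarrow> bool" where
  "prefix_free_machine M \<longleftrightarrow>
     partial_computable_machine M \<and>
     (\<forall>y p q. M p y \<noteq> None \<longrightarrow> M q y \<noteq> None \<longrightarrow> prefix p q \<longrightarrow> p = q)"

text \<open>Universality in the sense of additive optimality among prefix-free machines.\<close>
definition universal_pf_machine :: "machine \<Rightarrow> bool" where
  "universal_pf_machine U \<longleftrightarrow> prefix_free_machine U \<and>
     (\<forall>M. prefix_free_machine M \<longrightarrow>
        (\<exists>c::nat. \<forall>p x y. M p y = Some x \<longrightarrow> (\<exists>q. U q y = Some x \<and> length q \<le> length p + c)))"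

definition Kc :: "machine \<Rightarrow> bool list \<Rightarrow> bool list \<Rightarrow> nat" where
  "Kc U x y = (LEAST n. \<exists>p. length p = n \<and> U p y = Some x)"

definition Kp :: "machine \<Rightarrow> bool list \<Rightarrow> nat" where
  "Kp U x = Kc U x []"

definition NID :: "machine \<Rightarrow> bool list \<Rightarrow> bool list \<Rightarrow> rat" where
  "NID U x y = of_nat (max (Kc U x y) (Kc U y x)) / of_nat (max (Kp U x) (Kp U y))"

fun sig_shape :: "nat \<Rightarrow> (nat \<Rightarrow> rat) \<Rightarrow> bool"
and pi_shape :: "nat \<Rightarrow> (nat \<Rightarrow> rat) \<Rightarrow> bool" where
  "sig_shape 0 g = False"
| "sig_shape (Suc 0) g = mono g"
| "sig_shape (Suc (Suc n)) g =
     (\<exists>s0. mono_on {..<s0} g \<and> pi_shape (Suc n) (\<lambda>t. g (t + s0)))"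
| "pi_shape 0 g = False"
| "pi_shape (Suc 0) g = antimono g"
| "pi_shape (Suc (Suc n)) g =
     (\<exists>s0. antimono_on {..<s0} g \<and> sig_shape (Suc n) (\<lambda>t. g (t + s0)))"

definition computable_approx :: "(bool list \<Rightarrow> bool list \<Rightarrow> nat \<Rightarrow> rat) \<Rightarrow> bool" where
  "computable_approx f \<longleftrightarrow>
     (\<exists>c. \<forall>x y s r. eval c [bl_enc x, bl_enc y, s] r \<longleftrightarrow> r = rat_enc (f x y s))"

definition approximates :: "(bool list \<Rightarrow> bool list \<Rightarrow> nat \<Rightarrow> rat) \<Rightarrow> (bool list \<Rightarrow> bool list \<Rightarrow> rat) \<Rightarrow> bool" where
  "approximates f F \<longleftrightarrow> computable_approx f \<and>
     (\<forall>x y. (\<lambda>s. real_of_rat (f x y s)) \<longlonglongrightarrow> real_of_rat (F x y))"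

definition in_Sigma :: "nat \<Rightarrow> (bool list \<Rightarrow> bool list \<Rightarrow> rat) \<Rightarrow> bool" where
  "in_Sigma n F \<longleftrightarrow> (\<exists>f. approximates f F \<and> (\<forall>x y. sig_shape n (f x y)))"

definition in_Pi :: "nat \<Rightarrow> (bool list \<Rightarrow> bool list \<Rightarrow> rat) \<Rightarrow> bool" where
  "in_Pi n F \<longleftrightarrow> (\<exists>f. approximates f F \<and> (\<forall>x y. pi_shape n (f x y)))"

end

theory Submission
  imports Defs "HOL-Library.More_List"
begin

text \<open>Let \<open>f\<close> be a computable approximation of NID. In a product \<open>A \<times> B\<close> of two computable sets of
  \<open>2 ^ M\<close> strings most pairs are independent, so their NID is close to 1 and \<open>f\<close> must exceed \<open>2/3\<close>. Once
  this has been observed, split \<open>A\<close> and \<open>B\<close> into blocks of size \<open>2 ^ (M / 8)\<close> and computably search for a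
  matching of the blocks of \<open>A\<close> with those of \<open>B\<close> such that it has been observed for most pairs lying in
  matched blocks. For such pairs each component determines the block of the other one, hence the information
  distance drops to about \<open>M / 8\<close> while most components still have complexity about \<open>M\<close>, and \<open>f\<close> must fall
  below \<open>1/3\<close>. Once this has been observed, computably search for one pair of matched blocks most of whose
  pairs have gone through this oscillation. It is again a product of computable sets, of size \<open>2 ^ (M / 8)\<close>,
  and the argument repeats. Lower bounds on complexity come from counting programs, upper bounds from
  universality.\<close>

section \<open>Total computable functions\<close>

text \<open>A function takes an assignment of values to infinitely many variables, of which only the first \<open>n\<close>
  may matter; keeping \<open>n\<close> existential hides arities from the closure rules.\<close>

definition computes :: "recf \<Rightarrow> nat \<Rightarrow> ((nat \<Rightarrow> nat) \<Rightarrow> nat) \<Rightarrow> bool" where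
  "computes c n F \<longleftrightarrow> (\<forall>e r. eval c (map e [0..<n]) r \<longleftrightarrow> r = F e)"

definition computable :: "((nat \<Rightarrow> nat) \<Rightarrow> nat) \<Rightarrow> bool" where
  "computable F \<longleftrightarrow> (\<exists>n c. computes c n F)"

abbreviation computable1 :: "(nat \<Rightarrow> nat) \<Rightarrow> bool" where
  "computable1 F \<equiv> computable (\<lambda>e. F (e 0))"

abbreviation computable3 :: "(nat \<Rightarrow> nat \<Rightarrow> nat \<Rightarrow> nat) \<Rightarrow> bool" where
  "computable3 F \<equiv> computable (\<lambda>e. F (e 0) (e 1) (e 2))"

abbreviation decidable :: "((nat \<Rightarrow> nat) \<Rightarrow> bool) \<Rightarrow> bool" where
  "decidable P \<equiv> computable (\<lambda>e. of_bool (P e))"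

inductive_simps eval_Zr_iff: "eval Zr xs r"
  and eval_Sc_iff: "eval Sc xs r"
  and eval_Proj_iff: "eval (Proj i) xs r"
  and eval_Comp_iff_nth: "eval (Comp f gs) xs r"
  and eval_Prim_0_iff: "eval (Prim f g) (0 # xs) r"
  and eval_Prim_Suc_iff: "eval (Prim f g) (Suc n # xs) r"
  and eval_Mn_iff: "eval (Mn f) xs n"

lemma eval_Proj_nth_default: "eval (Proj i) xs r \<longleftrightarrow> r = nth_default 0 xs i"
  by (auto simp: eval_Proj_iff nth_default_def)

lemma eval_Comp_iff:
  "eval (Comp f gs) xs r \<longleftrightarrow> (\<exists>rs. list_all2 (\<lambda>g. eval g xs) gs rs \<and> eval f rs r)"
  unfolding eval_Comp_iff_nth list_all2_conv_all_nth by metis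

lemma eval_Comp_map:
  assumes "\<And>i r. i < n \<Longrightarrow> eval (d i) xs r \<longleftrightarrow> r = R i"
  shows "eval (Comp c (map d [0..<n])) xs r \<longleftrightarrow> eval c (map R [0..<n]) r"
proof -
  have "list_all2 (\<lambda>g. eval g xs) (map d [0..<n]) rs \<longleftrightarrow> rs = map R [0..<n]" for rs
  proof -
    have "list_all2 (\<lambda>g. eval g xs) (map d [0..<n]) rs \<longleftrightarrow> length rs = n \<and> (\<forall>i<n. rs ! i = R i)"
      using assms by (auto simp: list_all2_conv_all_nth)
    also have "\<dots> \<longleftrightarrow> rs = map R [0..<n]"
      by (simp add: list_eq_iff_nth_eq cong: conj_cong)
    finally show ?thesis .
  qed
  then show ?thesis by (simp add: eval_Comp_iff)
qed

lemma eval_Comp_Proj: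
  "eval (Comp c (map Proj [0..<n])) xs r \<longleftrightarrow> eval c (map (nth_default 0 xs) [0..<n]) r"
  by (intro eval_Comp_map eval_Proj_nth_default)

lemma eval_Prim_rec_nat:
  assumes "\<And>r. eval f xs r \<longleftrightarrow> r = z"
    and "\<And>i s r. eval g (s # i # xs) r \<longleftrightarrow> r = G i s"
  shows "eval (Prim f g) (n # xs) r \<longleftrightarrow> r = rec_nat z G n"
  by (induction n arbitrary: r) (simp_all add: eval_Prim_0_iff eval_Prim_Suc_iff assms)

lemma eval_Mn_decision:
  assumes "\<And>n r. eval f (n # xs) r \<longleftrightarrow> r = of_bool (\<not> P n)"
  shows "eval (Mn f) xs n \<longleftrightarrow> P n \<and> (\<forall>m<n. \<not> P m)"
  by (auto simp: eval_Mn_iff assms)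

lemma computes_more_variables:
  assumes "computes c n F" "n \<le> m"
  shows "\<exists>d. computes d m F"
proof -
  have "map (nth_default 0 (map e [0..<m])) [0..<n] = map e [0..<n]" for e :: "nat \<Rightarrow> nat"
    using assms(2) by (simp add: nth_default_def)
  then have "computes (Comp c (map Proj [0..<n])) m F"
    using assms(1) by (simp only: computes_def eval_Comp_Proj simp_thms)
  then show ?thesis by blast
qed

lemma computable_code:
  assumes "computable F"
  obtains c where "\<And>xs r. eval c xs r \<longleftrightarrow> r = F (nth_default 0 xs)"
proof -
  obtain n c where c: "computes c n F"
    using assms by (auto simp: computable_def)
  then have "eval (Comp c (map Proj [0..<n])) xs r \<longleftrightarrow> r = F (nth_default 0 xs)" for xs r
    by (simp add: computes_def eval_Comp_Proj)
  then show thesis by (rule that)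
qed

named_theorems computable_intros

lemma computable_var [computable_intros]: "computable (\<lambda>e. e i)"
  unfolding computable_def computes_def
  by (intro exI[of _ "Suc i"] exI[of _ "Proj i"])
    (simp add: eval_Proj_nth_default nth_default_def del: upt_Suc)

lemma computable_comp:
  assumes "computable F" and "\<And>i. computable (G i)"
  shows "computable (\<lambda>e. F (\<lambda>i. G i e))"
proof -
  obtain n c where c: "computes c n F"
    using assms(1) by (auto simp: computable_def)
  obtain k where k: "\<And>i. \<exists>d. computes d (k i) (G i)"
    using assms(2) unfolding computable_def by metis
  define m where "m = sum k {..<n}"
  have "k i \<le> m" if "i < n" for i
    unfolding m_def using that by (intro member_le_sum) auto
  then have "\<exists>d. computes d m (G i)" if "i < n" for i
    using k[of i] computes_more_variables that by blast
  then obtain d where d: "\<And>i. i < n \<Longrightarrow> computes (d i) m (G i)"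
    using bchoice[of "{..<n}" "\<lambda>i d. computes d m (G i)"] by auto
  have "eval (Comp c (map d [0..<n])) (map e [0..<m]) r \<longleftrightarrow> r = F (\<lambda>i. G i e)" for e r
  proof -
    have "eval (Comp c (map d [0..<n])) (map e [0..<m]) r \<longleftrightarrow> eval c (map (\<lambda>i. G i e) [0..<n]) r"
      using d by (intro eval_Comp_map) (simp add: computes_def)
    with c show ?thesis by (simp add: computes_def)
  qed
  then show ?thesis unfolding computable_def computes_def by blast
qed

lemma computable_shift:
  assumes "computable F"
  shows "computable (\<lambda>e. F (\<lambda>i. e (i + k)))" and "computable (\<lambda>e. F (\<lambda>i. e (Suc i)))"
  by (rule computable_comp[OF assms computable_var])+

lemma computable_comp1:
  assumes "computable1 F" "computable A"
  shows "computable (\<lambda>e. F (A e))"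
  using computable_comp[OF assms(1), of "\<lambda>_. A"] assms(2) by simp

lemma computable_comp3:
  assumes "computable3 F" "computable A" "computable B" "computable C"
  shows "computable (\<lambda>e. F (A e) (B e) (C e))"
  using computable_comp[OF assms(1), of "\<lambda>i. if i = 0 then A else if i = 1 then B else C"] assms(2-)
  by (simp split: if_splits)

lemma computable_comp4:
  assumes "computable (\<lambda>e. F (e 0) (e 1) (e 2) (e 3))"
    and "computable A" "computable B" "computable C" "computable D"
  shows "computable (\<lambda>e. F (A e) (B e) (C e) (D e))"
  using computable_comp[OF assms(1),
      of "\<lambda>i. if i = 0 then A else if i = 1 then B else if i = 2 then C else D"] assms(2-)
  by (simp split: if_splits)

lemma computable_Suc [computable_intros]:
  assumes "computable F"
  shows "computable (\<lambda>e. Suc (F e))"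
proof (rule computable_comp1[OF _ assms])
  show "computable1 Suc"
    unfolding computable_def computes_def
    by (intro exI[of _ 1] exI[of _ Sc]) (simp add: eval_Sc_iff)
qed

lemma computable_const [computable_intros]: "computable (\<lambda>e. k)"
proof (induction k)
  case 0
  show ?case
    unfolding computable_def computes_def by (intro exI[of _ 0] exI[of _ Zr]) (simp add: eval_Zr_iff)
qed (rule computable_Suc)

lemma computable_rec_nat:
  assumes B: "computable B" and F: "computable F"
    and G: "computable (\<lambda>e. G (e 0) (e 1) (\<lambda>i. e (i + 2)))"
  shows "computable (\<lambda>e. rec_nat (F e) (\<lambda>i r. G r i e) (B e))"
proof -
  obtain n1 n2 where "\<exists>c. computes c n1 F" "\<exists>d. computes d n2 (\<lambda>e. G (e 0) (e 1) (\<lambda>i. e (i + 2)))"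
    using F G by (auto simp: computable_def)
  then obtain n c d where c: "computes c n F"
    and d: "computes d (Suc (Suc n)) (\<lambda>e. G (e 0) (e 1) (\<lambda>i. e (i + 2)))"
    using computes_more_variables[of _ n1 F "max n1 n2"]
      computes_more_variables[of _ n2 _ "Suc (Suc (max n1 n2))"] by fastforce
  have d_step: "eval d (s # i # map e [0..<n]) r \<longleftrightarrow> r = G s i e" for s i e r
    using d[unfolded computes_def, rule_format, of "case_nat s (case_nat i e)" r]
    by (simp add: map_upt_Suc del: upt_Suc)
  have "computes (Prim c d) (Suc n)
      (\<lambda>e. rec_nat (F (\<lambda>i. e (Suc i))) (\<lambda>i r. G r i (\<lambda>i. e (Suc i))) (e 0))"
    unfolding computes_def map_upt_Suc
    using c d_step by (intro allI eval_Prim_rec_nat) (simp_all add: computes_def)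
  then have rec: "computable (\<lambda>e. rec_nat (F (\<lambda>i. e (Suc i))) (\<lambda>i r. G r i (\<lambda>i. e (Suc i))) (e 0))"
    unfolding computable_def by blast
  have "computable (\<lambda>e. case_nat (B e) e i)" for i
    by (cases i) (simp_all add: B computable_var)
  from computable_comp[where G = "\<lambda>i e. case_nat (B e) e i", OF rec this] show ?thesis by simp
qed

lemma computable_add [computable_intros]:
  assumes "computable A" "computable B"
  shows "computable (\<lambda>e. A e + B e)"
proof -
  have "computable (\<lambda>e. rec_nat (A e) (\<lambda>i r. Suc r) (B e))"
    by (intro computable_rec_nat assms computable_intros)
  moreover have "rec_nat a (\<lambda>i r. Suc r) b = a + b" for a b by (induction b) auto
  ultimately show ?thesis by simp
qed

lemma computable_sum [computable_intros]:
  assumes "computable B" and G: "computable (\<lambda>e. G (e 0) (\<lambda>i. e (Suc i)))"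
  shows "computable (\<lambda>e. \<Sum>i<B e. G i e)"
proof -
  have "computable (\<lambda>e. G (e 1) (\<lambda>i. e (i + 2)))"
    using computable_shift(2)[OF G] by simp
  then have "computable (\<lambda>e. rec_nat 0 (\<lambda>i r. r + G i e) (B e))"
    by (intro computable_rec_nat assms computable_intros)
  moreover have "rec_nat 0 (\<lambda>i r. r + g i) b = (\<Sum>i<b. g i)" for g :: "nat \<Rightarrow> nat" and b
    by (induction b) auto
  ultimately show ?thesis by simp
qed

lemma computable_mult [computable_intros]:
  assumes "computable A" "computable B"
  shows "computable (\<lambda>e. A e * B e)"
proof -
  have "computable (\<lambda>e. \<Sum>i<B e. A e)"
    by (intro computable_intros assms computable_shift[OF assms(1)])
  then show ?thesis by (simp add: mult.commute)
qed

lemma computable_power [computable_intros]: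
  assumes "computable A" "computable B"
  shows "computable (\<lambda>e. A e ^ B e)"
proof -
  have "computable (\<lambda>e. rec_nat 1 (\<lambda>i r. r * A e) (B e))"
    by (intro computable_rec_nat assms computable_intros computable_shift[OF assms(1)])
  moreover have "rec_nat 1 (\<lambda>i r. r * a) b = a ^ b" for a b :: nat by (induction b) auto
  ultimately show ?thesis by simp
qed

lemma computable_diff [computable_intros]:
  assumes "computable A" "computable B"
  shows "computable (\<lambda>e. A e - B e)"
proof -
  have pred: "computable (\<lambda>e. F e - 1)" if "computable F" for F
  proof -
    have "computable (\<lambda>e. rec_nat 0 (\<lambda>i r. i) (F e))"
      by (intro computable_rec_nat that computable_intros)
    moreover have "rec_nat 0 (\<lambda>i r. i) a = a - 1" for a by (cases a) auto
    ultimately show ?thesis by simp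
  qed
  have "computable (\<lambda>e. rec_nat (A e) (\<lambda>i r. r - 1) (B e))"
    by (intro computable_rec_nat assms pred computable_var)
  moreover have "rec_nat a (\<lambda>i r. r - 1) b = a - b" for a b :: nat by (induction b) auto
  ultimately show ?thesis by simp
qed

lemma decidable_not [computable_intros]:
  assumes "decidable P"
  shows "decidable (\<lambda>e. \<not> P e)"
proof -
  have "computable (\<lambda>e. 1 - of_bool (P e))"
    by (intro computable_intros assms)
  moreover have "1 - of_bool p = (of_bool (\<not> p) :: nat)" for p by auto
  ultimately show ?thesis by simp
qed

lemma decidable_conj [computable_intros]:
  assumes "decidable P" "decidable Q"
  shows "decidable (\<lambda>e. P e \<and> Q e)"
  using computable_mult[OF assms] by (simp add: of_bool_conj)

lemma decidable_disj [computable_intros]: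
  assumes "decidable P" "decidable Q"
  shows "decidable (\<lambda>e. P e \<or> Q e)"
proof -
  have "decidable (\<lambda>e. \<not> (\<not> P e \<and> \<not> Q e))"
    by (intro computable_intros assms)
  then show ?thesis by simp
qed

lemma decidable_less [computable_intros]:
  assumes "computable A" "computable B"
  shows "decidable (\<lambda>e. A e < B e)"
proof -
  have "computable (\<lambda>e. 1 - (1 - (B e - A e)))"
    by (intro computable_intros assms)
  moreover have "1 - (1 - (b - a)) = (of_bool (a < b) :: nat)" for a b :: nat by auto
  ultimately show ?thesis by simp
qed

lemma decidable_le [computable_intros]:
  assumes "computable A" "computable B"
  shows "decidable (\<lambda>e. A e \<le> B e)"
  using decidable_not[OF decidable_less[OF assms(2,1)]] by (simp add: not_less)

lemma decidable_eq [computable_intros]: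
  assumes "computable A" "computable B"
  shows "decidable (\<lambda>e. A e = B e)"
  using decidable_conj[OF decidable_le[OF assms] decidable_le[OF assms(2,1)]]
  by (simp add: eq_iff)

lemma decidable_bex [computable_intros]:
  assumes "computable B" and "decidable (\<lambda>e. P (e 0) (\<lambda>i. e (Suc i)))"
  shows "decidable (\<lambda>e. \<exists>i\<le>B e. P i e)"
proof -
  have "decidable (\<lambda>e. (0::nat) < (\<Sum>i<Suc (B e). of_bool (P i e)))"
    by (intro computable_intros assms)
  moreover have "0 < (\<Sum>i<Suc b. of_bool (p i) :: nat) \<longleftrightarrow> (\<exists>i\<le>b. p i)" for p and b
    by (auto simp: zero_less_iff_neq_zero less_Suc_eq_le simp del: sum.lessThan_Suc)
  ultimately show ?thesis by (simp only:)
qed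

lemma computable_Least:
  assumes P: "decidable (\<lambda>e. P (e 0) (\<lambda>i. e (Suc i)))" and ex: "\<And>e. \<exists>n. P n e"
  shows "computable (\<lambda>e. LEAST n. P n e)"
proof -
  obtain n c where "computes c n (\<lambda>e. of_bool (\<not> P (e 0) (\<lambda>i. e (Suc i))))"
    using decidable_not[OF P] by (auto simp: computable_def)
  then obtain c where c: "computes c (Suc n) (\<lambda>e. of_bool (\<not> P (e 0) (\<lambda>i. e (Suc i))))"
    using computes_more_variables by (meson le_SucI order_refl)
  have "eval (Mn c) (map e [0..<n]) r \<longleftrightarrow> r = (LEAST n. P n e)" for e r
  proof -
    have "eval c (k # map e [0..<n]) s \<longleftrightarrow> s = of_bool (\<not> P k e)" for k s
      using c[unfolded computes_def, rule_format, of "case_nat k e" s]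
      by (simp add: map_upt_Suc del: upt_Suc)
    then have "eval (Mn c) (map e [0..<n]) r \<longleftrightarrow> P r e \<and> (\<forall>m<r. \<not> P m e)"
      by (rule eval_Mn_decision)
    also have "\<dots> \<longleftrightarrow> r = (LEAST n. P n e)"
      using ex[of e] by (metis LeastI_ex Least_equality not_less not_less_Least)
    finally show ?thesis .
  qed
  then show ?thesis unfolding computable_def computes_def by blast
qed

lemma computable_div [computable_intros]:
  assumes "computable A" "computable B" "\<And>e. B e > 0"
  shows "computable (\<lambda>e. A e div B e)"
proof -
  have "A e < Suc (A e) * B e" for e
    using mult_le_mono2[of 1 "B e" "Suc (A e)"] assms(3)[of e] by simp
  then have "\<exists>q. A e < Suc q * B e" for e by blast
  then have "computable (\<lambda>e. LEAST q. A e < Suc q * B e)"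
    by (intro computable_Least computable_intros computable_shift[OF assms(1)] computable_shift[OF assms(2)])
  moreover have "(LEAST q. A e < Suc q * B e) = A e div B e" for e
    using assms(3)[of e]
    by (intro Least_equality) (simp_all add: less_Suc_eq_le div_less_iff_less_mult[symmetric] del: mult_Suc)
  ultimately show ?thesis by simp
qed

lemma computable_mod [computable_intros]:
  assumes "computable A" "computable B" "\<And>e. B e > 0"
  shows "computable (\<lambda>e. A e mod B e)"
  using computable_diff[OF assms(1) computable_mult[OF computable_div[OF assms] assms(2)]]
  by (simp add: minus_div_mult_eq_mod)

lemma computable_card_pairs:
  assumes N: "computable N"
    and P: "decidable (\<lambda>e. P (e 1) (e 0) (\<lambda>i. e (i + 2)))"
    and bounded: "\<And>e x y. P x y e \<Longrightarrow> x < N e \<and> y < N e"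
  shows "computable (\<lambda>e. card {(x, y). P x y e})"
proof -
  have "card {(x, y). P x y e} = (\<Sum>x<N e. \<Sum>y<N e. of_bool (P x y e))" for e
  proof -
    have "{(x, y). P x y e} = Sigma {..<N e} (\<lambda>x. {..<N e} \<inter> {y. P x y e})"
      using bounded by auto
    then show ?thesis by simp
  qed
  moreover have "computable (\<lambda>e. \<Sum>x<N e. \<Sum>y<N e. of_bool (P x y e))"
    using P by (intro computable_sum N computable_shift[OF N]) simp
  ultimately show ?thesis by simp
qed

text \<open>\<open>\<exists>s. Q m j s\<close> is only semidecidable in \<open>j\<close>, so a common bound for \<open>j\<close> and \<open>s\<close> is searched for first.\<close>

lemma computable_choice:
  assumes Q: "decidable (\<lambda>e. Q (e 0) (e 1) (e 2))" and ex: "\<forall>\<^sub>F m in sequentially. \<exists>j s. Q m j s"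
  obtains J where "computable1 J" "\<forall>\<^sub>F m in sequentially. \<exists>s. Q m (J m) s"
proof -
  obtain m0 where m0: "\<And>m. m \<ge> m0 \<Longrightarrow> \<exists>j s. Q m j s"
    using ex by (auto simp: eventually_sequentially)
  define Q' where "Q' m j s \<longleftrightarrow> m < m0 \<or> Q m j s" for m j s
  define S where "S m = (LEAST n. \<exists>j\<le>n. \<exists>s\<le>n. Q' m j s)" for m
  define J where "J m = (LEAST j. \<exists>s\<le>S m. Q' m j s)" for m
  have Q': "decidable (\<lambda>e. Q' (A e) (B e) (C e))"
    if "computable A" "computable B" "computable C" for A B C
    unfolding Q'_def using computable_comp3[where F = "\<lambda>m j s. of_bool (Q m j s)", OF Q that]
    by (intro computable_intros that)
  have S_ex: "\<exists>n. \<exists>j\<le>n. \<exists>s\<le>n. Q' m j s" for m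
    using m0[of m] unfolding Q'_def by (meson max.cobounded1 max.cobounded2 not_le)
  have S: "computable1 S"
    unfolding S_def by (intro computable_Least computable_intros Q' S_ex)
  have J_ex: "\<exists>j. \<exists>s\<le>S m. Q' m j s" for m
    using LeastI_ex[OF S_ex[of m]] unfolding S_def by blast
  have "\<exists>s. Q' m (J m) s" for m
    using LeastI_ex[OF J_ex[of m]] unfolding J_def by blast
  then have "\<forall>\<^sub>F m in sequentially. \<exists>s. Q m (J m) s"
    unfolding Q'_def eventually_sequentially by (meson not_less)
  moreover have "computable1 J"
    unfolding J_def by (intro computable_Least computable_intros Q' J_ex computable_comp1[OF S])
  ultimately show thesis by (intro that)
qed

lemma partial_recursive_search:
  assumes "decidable (\<lambda>e. P (e 0) (e 1) (e 2))" and "computable3 H"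
  obtains c where "\<And>x y r. eval c [x, y] r \<longleftrightarrow> (\<exists>m. P m x y \<and> (\<forall>k<m. \<not> P k x y) \<and> r = H m x y)"
proof -
  obtain p where p: "\<And>xs r. eval p xs r \<longleftrightarrow> r = of_bool (\<not> P (nth_default 0 xs 0) (nth_default 0 xs 1)
      (nth_default 0 xs 2))"
    using computable_code[OF decidable_not[OF assms(1)]] by blast
  obtain h where h: "\<And>xs r. eval h xs r \<longleftrightarrow> r = H (nth_default 0 xs 0) (nth_default 0 xs 1)
      (nth_default 0 xs 2)"
    using computable_code[OF assms(2)] by blast
  have "eval (Mn p) [x, y] m \<longleftrightarrow> P m x y \<and> (\<forall>k<m. \<not> P k x y)" for x y m
    by (rule eval_Mn_decision) (simp add: p numeral_2_eq_2)
  then have "eval (Comp h [Mn p, Proj 0, Proj 1]) [x, y] r \<longleftrightarrow>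
      (\<exists>m. P m x y \<and> (\<forall>k<m. \<not> P k x y) \<and> r = H m x y)" for x y r
    by (auto simp: eval_Comp_iff list_all2_Cons1 eval_Proj_nth_default h numeral_2_eq_2)
  then show thesis by (rule that)
qed

section \<open>Self-delimiting programs\<close>

definition bl_dec :: "nat \<Rightarrow> bool list" where
  "bl_dec = inv bl_enc"

lemma inj_bl_enc: "inj bl_enc"
proof (rule injI)
  show "p = q" if "bl_enc p = bl_enc q" for p q
    using that
  proof (induction p arbitrary: q)
    case Nil
    then show ?case by (cases q) (auto split: if_splits)
  next
    case (Cons b p)
    obtain b' q' where q: "q = b' # q'"
      using Cons.prems by (cases q) (auto split: if_splits)
    have "b = b' \<and> bl_enc p = bl_enc q'"
      using Cons.prems unfolding q by (cases b; cases b'; simp; presburger)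
    then show ?case using Cons.IH q by auto
  qed
qed

lemma surj_bl_enc: "surj bl_enc"
proof -
  have "\<exists>p. bl_enc p = n" for n
  proof (induction n rule: less_induct)
    case (less n)
    consider (zero) "n = 0" | (odd) k where "n = 2 * k + 1" | (even) k where "n = 2 * k + 2"
      by atomize_elim presburger
    then show ?case
    proof cases
      case zero
      then show ?thesis by (intro exI[of _ "[]"]) simp
    next
      case (odd k)
      then obtain p where "bl_enc p = k" using less[of k] by auto
      then show ?thesis using odd by (intro exI[of _ "False # p"]) simp
    next
      case (even k)
      then obtain p where "bl_enc p = k" using less[of k] by auto
      then show ?thesis using even by (intro exI[of _ "True # p"]) simp
    qed
  qed
  then show ?thesis by (metis surjI)
qed

lemma bl_enc_bl_dec [simp]: "bl_enc (bl_dec n) = n"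
  unfolding bl_dec_def by (rule surj_f_inv_f[OF surj_bl_enc])

lemma bl_dec_bl_enc [simp]: "bl_dec (bl_enc p) = p"
  unfolding bl_dec_def by (rule inv_f_f[OF inj_bl_enc])

lemma bl_dec_eq_iff [simp]: "bl_dec m = bl_dec n \<longleftrightarrow> m = n"
  by (metis bl_enc_bl_dec)

lemma bl_dec_0 [simp]: "bl_dec 0 = []"
  by (metis bl_dec_bl_enc bl_enc.simps(1))

lemma bl_enc_bounds: "2 ^ length p \<le> bl_enc p + 1" "bl_enc p + 1 < 2 ^ Suc (length p)"
  by (induction p) auto

lemma length_bl_dec:
  assumes "2 ^ n \<le> i + 1" "i + 1 < 2 ^ Suc n"
  shows "length (bl_dec i) = n"
proof -
  have "(2::nat) ^ n < 2 ^ Suc (length (bl_dec i))" "(2::nat) ^ length (bl_dec i) < 2 ^ Suc n"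
    using assms bl_enc_bounds[of "bl_dec i"] by simp_all
  then show ?thesis by (simp only: power_strict_increasing_iff)
qed

text \<open>The strings of length \<open>n\<close> are the values of \<open>bl_dec\<close> on \<open>2 ^ n - 1, \<dots>, 2 ^ (n + 1) - 2\<close>. The unary
  header is affordable because all \<open>n\<close> occurring below are at least \<open>8 * m\<close>.\<close>

definition program :: "nat \<Rightarrow> nat \<Rightarrow> nat \<Rightarrow> bool list" where
  "program m n v = replicate m False @ True # bl_dec (2 ^ n + v - 1)"

lemma bl_enc_program: "bl_enc (program m n v) + 1 = 2 ^ m * (2 * (2 ^ n + v) + 1)"
proof -
  have "bl_enc (replicate m False @ True # u) + 1 = 2 ^ m * (2 * (bl_enc u + 1) + 1)" for u
    by (induction m) (auto simp: algebra_simps)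
  moreover have "2 ^ n + v - 1 + 1 = 2 ^ n + v" by simp
  ultimately show ?thesis by (simp only: program_def bl_enc_bl_dec)
qed

lemma eq_program_iff: "p = program m n v \<longleftrightarrow> bl_enc p + 1 = 2 ^ m * (2 * (2 ^ n + v) + 1)"
  by (metis bl_enc_program add_right_cancel inj_bl_enc injD)

lemma payload_le_bl_enc_program: "v \<le> bl_enc (program m n v)"
  using bl_enc_program[of m n v] mult_le_mono1[of 1 "2 ^ m" "2 * (2 ^ n + v) + 1"] by simp

lemma bl_enc_program_div: "(bl_enc (program m n v) + 1) div 2 ^ Suc m = 2 ^ n + v"
  unfolding bl_enc_program power_Suc2 div_mult2_eq by simp

lemma length_program: "v < 2 ^ n \<Longrightarrow> length (program m n v) = m + n + 1"
  by (simp add: program_def length_bl_dec)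

lemma prefix_program_unique:
  assumes "prefix (program m (l m) v) (program m' (l m') v')" "v < 2 ^ l m" "v' < 2 ^ l m'"
  shows "m = m'" and "v = v'"
proof -
  obtain w where w: "program m' (l m') v' = program m (l m) v @ w"
    using assms(1) by (auto simp: prefix_def)
  have takeWhile_program: "takeWhile Not (program k n u @ w) = replicate k False" for k n u w
    by (simp add: program_def takeWhile_append)
  have "replicate m' False = replicate m False"
    using takeWhile_program[of m' _ _ "[]"] takeWhile_program[of m] w by (metis append_Nil2)
  then show "m = m'" by simp
  with w have "program m (l m) v = program m (l m) v'"
    using assms(2,3) length_program by (metis append_eq_append_conv append_Nil2)
  then show "v = v'"
    using bl_enc_program[of m "l m" v] bl_enc_program[of m "l m" v'] by simp
qed

definition decoder :: "(nat \<Rightarrow> nat) \<Rightarrow> (nat \<Rightarrow> nat \<Rightarrow> nat \<Rightarrow> nat) \<Rightarrow> machine" where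
  "decoder l h p y =
    (if \<exists>m v. v < 2 ^ l m \<and> p = program m (l m) v
     then Some (bl_dec (THE r. \<exists>m v. v < 2 ^ l m \<and> p = program m (l m) v \<and> r = h m v (bl_enc y)))
     else None)"

lemma decoder_program:
  assumes "v < 2 ^ l m"
  shows "decoder l h (program m (l m) v) y = Some (bl_dec (h m v (bl_enc y)))"
proof -
  have "(THE r. \<exists>k u. u < 2 ^ l k \<and> program m (l m) v = program k (l k) u \<and> r = h k u (bl_enc y)) =
      h m v (bl_enc y)"
  proof (rule the_equality)
    fix r assume "\<exists>k u. u < 2 ^ l k \<and> program m (l m) v = program k (l k) u \<and> r = h k u (bl_enc y)"
    then obtain k u where ku: "u < 2 ^ l k" "program m (l m) v = program k (l k) u" "r = h k u (bl_enc y)"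
      by blast
    then have "m = k" "v = u" using prefix_program_unique[of m l v k u] assms by simp_all
    with ku(3) show "r = h m v (bl_enc y)" by simp
  qed (use assms in blast)
  then show ?thesis unfolding decoder_def using assms by auto
qed

lemma decoder_eq_None: "(\<And>m v. v < 2 ^ l m \<Longrightarrow> p \<noteq> program m (l m) v) \<Longrightarrow> decoder l h p y = None"
  unfolding decoder_def by auto

lemma decoder_defined_iff: "decoder l h p y \<noteq> None \<longleftrightarrow> (\<exists>m v. v < 2 ^ l m \<and> p = program m (l m) v)"
  using decoder_program decoder_eq_None by fastforce

lemma partial_computable_decoder:
  assumes l: "computable1 l" and h: "computable3 h"
  shows "partial_computable_machine (decoder l h)"
proof -
  define header where "header m P Y \<longleftrightarrow> (\<exists>v\<le>P. v < 2 ^ l m \<and> P + 1 = 2 ^ m * (2 * (2 ^ l m + v) + 1))"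
    for m P Y :: nat
  define out where "out m P Y = h m ((P + 1) div 2 ^ Suc m - 2 ^ l m) Y" for m P Y
  have header_iff: "header m (bl_enc p) Y \<longleftrightarrow> (\<exists>v<2 ^ l m. p = program m (l m) v)" for m p Y
    unfolding header_def eq_program_iff[symmetric] using payload_le_bl_enc_program by auto
  have out_program: "out m (bl_enc (program m (l m) v)) Y = h m v Y" for m v Y
    unfolding out_def bl_enc_program_div by simp
  have "decidable (\<lambda>e. header (e 0) (e 1) (e 2))"
    unfolding header_def by (intro computable_intros computable_comp1[OF l])
  moreover have "computable3 out"
    unfolding out_def by (intro computable_comp3[OF h] computable_intros computable_comp1[OF l]) simp
  ultimately obtain c where c: "\<And>P Y r. eval c [P, Y] r \<longleftrightarrow>
      (\<exists>m. header m P Y \<and> (\<forall>k<m. \<not> header k P Y) \<and> r = out m P Y)"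
    by (rule partial_recursive_search[of header out]) blast
  have "eval c [bl_enc p, bl_enc y] r \<longleftrightarrow> (\<exists>z. decoder l h p y = Some z \<and> r = bl_enc z)" for p y r
  proof (cases "\<exists>m v. v < 2 ^ l m \<and> p = program m (l m) v")
    case True
    then obtain m v where p: "v < 2 ^ l m" "p = program m (l m) v" by blast
    have "header k (bl_enc p) Y \<longleftrightarrow> k = m" for k Y
      unfolding header_iff p(2) using p(1) prefix_program_unique(1)[of m l v k]
      by (metis prefix_order.order_refl)
    then show ?thesis
      by (auto simp: c p decoder_program out_program)
  next
    case False
    then show ?thesis by (auto simp: c header_iff decoder_def)
  qed
  then show ?thesis unfolding partial_computable_machine_def by blast
qed

lemma prefix_free_decoder:
  assumes "computable1 l" and "computable3 h"
  shows "prefix_free_machine (decoder l h)"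
  unfolding prefix_free_machine_def decoder_defined_iff
  using partial_computable_decoder[OF assms] prefix_program_unique by blast

section \<open>Upper and lower bounds on complexity\<close>

locale universal_machine =
  fixes U :: machine
  assumes universal: "universal_pf_machine U"
begin

lemma ex_short_program:
  assumes "computable1 l" and "computable3 h"
  shows "\<exists>C. \<forall>m v y. v < 2 ^ l m \<longrightarrow>
    (\<exists>q. U q (bl_dec y) = Some (bl_dec (h m v y)) \<and> length q \<le> m + l m + C)"
proof -
  obtain C where C: "\<And>p x y. decoder l h p y = Some x \<Longrightarrow> \<exists>q. U q y = Some x \<and> length q \<le> length p + C"
    using universal prefix_free_decoder[OF assms] unfolding universal_pf_machine_def by blast
  have "\<exists>q. U q (bl_dec y) = Some (bl_dec (h m v y)) \<and> length q \<le> m + l m + Suc C"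
    if "v < 2 ^ l m" for m v y
    using C[OF decoder_program[where l = l and h = h and y = "bl_dec y", OF that]] length_program[OF that]
    by simp
  then show ?thesis by blast
qed

lemma Kc_upper_bound:
  assumes "computable1 l" and "computable3 h"
  shows "\<exists>C. \<forall>m v y. v < 2 ^ l m \<longrightarrow> Kc U (bl_dec (h m v y)) (bl_dec y) \<le> m + l m + C"
proof -
  have "Kc U x y \<le> length q" if "U q y = Some x" for q x y
    unfolding Kc_def using that by (intro Least_le) auto
  then show ?thesis
    using ex_short_program[OF assms] by (meson le_trans)
qed

lemma ex_shortest_program: "\<exists>p. length p = Kc U x y \<and> U p y = Some x"
proof -
  have "\<exists>C. \<forall>m v y. v < (2::nat) ^ 0 \<longrightarrow>
      (\<exists>q. U q (bl_dec y) = Some (bl_dec m) \<and> length q \<le> m + 0 + C)"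
    by (rule ex_short_program) (intro computable_intros)+
  then obtain q where "U q (bl_dec (bl_enc y)) = Some (bl_dec (bl_enc x))"
    by (metis less_one power_0)
  then have "\<exists>n p. length p = n \<and> U p y = Some x" by auto
  then show ?thesis unfolding Kc_def by (rule LeastI_ex)
qed

lemma Kc_pos: "Kc U x y > 0"
proof (rule ccontr)
  assume "\<not> Kc U x y > 0"
  then have x: "U [] y = Some x" using ex_shortest_program[of x y] by auto
  obtain p where p: "U p y = Some (True # x)" using ex_shortest_program[of "True # x" y] by blast
  have "[] = p"
    using universal x p unfolding universal_pf_machine_def prefix_free_machine_def
    by (metis Nil_prefix option.distinct(1))
  with x p show False by simp
qed

lemma card_Kc_less: "card {i. Kc U (bl_dec i) y < n} \<le> 2 ^ n" (is "card ?A \<le> _")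
  and finite_Kc_less: "finite {i. Kc U (bl_dec i) y < n}"
proof -
  obtain g where g: "\<And>x. length (g x) = Kc U x y" "\<And>x. U (g x) y = Some x"
    using ex_shortest_program[of _ y] by metis
  have inj: "inj_on (\<lambda>i. bl_enc (g (bl_dec i))) ?A"
    using g(2) by (intro inj_onI) (metis bl_dec_eq_iff inj_bl_enc injD option.inject)
  have sub: "(\<lambda>i. bl_enc (g (bl_dec i))) ` ?A \<subseteq> {..<2 ^ n}"
  proof clarify
    fix i assume "Kc U (bl_dec i) y < n"
    then have "2 ^ Suc (length (g (bl_dec i))) \<le> (2::nat) ^ n"
      unfolding g(1) by (intro power_increasing) auto
    then show "bl_enc (g (bl_dec i)) < 2 ^ n"
      using bl_enc_bounds(2)[of "g (bl_dec i)"] by linarith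
  qed
  show "card ?A \<le> 2 ^ n"
    using card_inj_on_le[OF inj sub] by simp
  show "finite ?A"
    using inj_on_finite[OF inj sub] by simp
qed

lemma
  assumes "b > 0"
  shows less_NID_iff: "of_nat a / of_nat b < NID U x y \<longleftrightarrow>
      a * max (Kp U x) (Kp U y) < b * max (Kc U x y) (Kc U y x)" (is "_ \<longleftrightarrow> a * ?d < b * ?n")
    and NID_less_iff: "NID U x y < of_nat a / of_nat b \<longleftrightarrow>
      b * max (Kc U x y) (Kc U y x) < a * max (Kp U x) (Kp U y)"
proof -
  define n d where "n = ?n" and "d = ?d"
  have "d > 0"
    unfolding d_def Kp_def using Kc_pos by (simp add: less_max_iff_disj)
  then have "of_nat a / of_nat b < NID U x y \<longleftrightarrow> of_nat (a * d) < (of_nat (b * n) :: rat)"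
    and "NID U x y < of_nat a / of_nat b \<longleftrightarrow> of_nat (b * n) < (of_nat (a * d) :: rat)"
    using assms unfolding NID_def n_def[symmetric] d_def[symmetric] by (simp_all add: field_simps)
  then show "of_nat a / of_nat b < NID U x y \<longleftrightarrow> a * ?d < b * ?n"
    and "NID U x y < of_nat a / of_nat b \<longleftrightarrow> b * ?n < a * ?d"
    unfolding n_def[symmetric] d_def[symmetric] of_nat_less_iff by blast+
qed

end

section \<open>Oscillations\<close>

definition beyond :: "'a :: linorder \<Rightarrow> 'a \<Rightarrow> nat \<Rightarrow> 'a \<Rightarrow> bool" where
  "beyond lo hi k v \<longleftrightarrow> (if even k then hi < v else v < lo)"

primrec oscillates :: "'a :: linorder \<Rightarrow> 'a \<Rightarrow> (nat \<Rightarrow> 'a) \<Rightarrow> nat \<Rightarrow> nat \<Rightarrow> bool" where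
  "oscillates lo hi g 0 s \<longleftrightarrow> True"
| "oscillates lo hi g (Suc k) s \<longleftrightarrow> (\<exists>t\<le>s. oscillates lo hi g k t \<and> beyond lo hi k (g t))"

lemma oscillates_mono: "oscillates lo hi g k s \<Longrightarrow> s \<le> s' \<Longrightarrow> oscillates lo hi g k s'"
  by (cases k) (auto intro: le_trans)

lemma oscillates_antimono: "oscillates lo hi g k s \<Longrightarrow> j \<le> k \<Longrightarrow> oscillates lo hi g j s"
proof (induction k arbitrary: s)
  case (Suc k)
  then show ?case
    by (cases "j = Suc k") (auto dest: oscillates_mono)
qed simp

lemma eventually_beyond:
  fixes g :: "'b \<Rightarrow> 'a :: linorder_topology"
  assumes "(g \<longlongrightarrow> L) F" "beyond lo hi k L"
  shows "\<forall>\<^sub>F t in F. beyond lo hi k (g t)"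
  using assms order_tendstoD[of g L F] by (cases "even k") (simp_all add: beyond_def)

lemma beyond_of_rat: "beyond (of_rat lo) (of_rat hi) k (of_rat v :: real) \<longleftrightarrow> beyond lo hi k v"
  by (simp add: beyond_def of_rat_less)

lemma monotone_segment_oscillates_le_2:
  assumes "mono_on {..<s} g \<or> antimono_on {..<s} g" "lo \<le> hi" "oscillates lo hi g k t" "t < s"
  shows "k \<le> 2"
proof (rule ccontr)
  assume "\<not> k \<le> 2"
  then have "oscillates lo hi g 3 t"
    by (intro oscillates_antimono[OF assms(3)]) simp
  then obtain t0 t1 t2 where "t0 \<le> t1" "t1 \<le> t2" "t2 \<le> t" "hi < g t0" "g t1 < lo" "hi < g t2"
    by (auto simp: numeral_3_eq_3 beyond_def)
  moreover from this assms(1,4) have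
    "g t0 \<le> g t1 \<and> g t1 \<le> g t2 \<or> g t1 \<le> g t0 \<and> g t2 \<le> g t1"
    by (auto simp: monotone_on_def)
  ultimately show False using assms(2) by auto
qed

lemma oscillates_tail:
  assumes "mono_on {..<s0} g \<or> antimono_on {..<s0} g" "lo \<le> hi" "oscillates lo hi g (k + 2) s"
  shows "oscillates lo hi (\<lambda>t. g (t + s0)) k (s - s0)"
  using assms(3)
proof (induction k arbitrary: s)
  case (Suc k)
  then obtain t where t: "t \<le> s" "oscillates lo hi g (k + 2) t" "beyond lo hi (k + 2) (g t)"
    by auto
  have "t \<ge> s0"
    using monotone_segment_oscillates_le_2[OF assms(1,2), of "Suc (k + 2)" t] t(2,3)
    by (auto simp: not_less[symmetric])
  with t show ?case
    using Suc.IH[OF t(2)] by (auto intro!: exI[of _ "t - s0"] diff_le_mono simp: beyond_def)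
qed simp

lemma shape_oscillates_le:
  assumes "sig_shape n g \<or> pi_shape n g" "lo \<le> hi" "oscillates lo hi g k s"
  shows "k \<le> 2 * n"
  using assms(1,3)
proof (induction n arbitrary: g k s)
  case (Suc n)
  show ?case
  proof (cases n)
    case 0
    then have "mono_on {..<Suc s} g \<or> antimono_on {..<Suc s} g"
      using Suc.prems(1) by (auto intro: mono_on_subset[of UNIV] monotone_on_subset[of UNIV])
    then show ?thesis
      using monotone_segment_oscillates_le_2[OF _ assms(2) Suc.prems(2)] 0 by simp
  next
    case (Suc n')
    then obtain s0 where s0: "mono_on {..<s0} g \<or> antimono_on {..<s0} g"
      "sig_shape n (\<lambda>t. g (t + s0)) \<or> pi_shape n (\<lambda>t. g (t + s0))"
      using Suc.prems(1) by auto
    consider (short) "k < 2" | (long) j where "k = j + 2"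
      by (metis le_add_diff_inverse2 not_less)
    then show ?thesis
    proof cases
      case (long j)
      then have "j \<le> 2 * n"
        using Suc.IH[OF s0(2)] oscillates_tail[OF s0(1) assms(2)] Suc.prems(2) by blast
      then show ?thesis using long by simp
    qed simp
  qed
qed simp

section \<open>Deciding oscillations\<close>

lemma double_prod_encode: "2 * prod_encode (m, n) = (m + n) * (m + n + 1) + 2 * m"
proof -
  have "even ((m + n) * Suc (m + n))" by simp
  then show ?thesis by (simp add: prod_encode_def triangle_def)
qed

lemma int_encode_eq_even_iff: "int_encode i = 2 * a \<longleftrightarrow> i = int a"
proof -
  have "int_encode (int a) = 2 * a" by (simp add: int_encode_def sum_encode_def)
  then show ?thesis by (metis inj_int_encode injD)
qed

lemma quotient_of_eq_iff_rat_enc: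
  "quotient_of q = (int a, int b) \<longleftrightarrow> rat_enc q = prod_encode (2 * a, 2 * b)"
  unfolding rat_enc_def prod_encode_eq by (auto simp: int_encode_eq_even_iff prod_eq_iff)

lemma decidable_quotient_of:
  assumes P: "decidable (\<lambda>e. P (e 0) (e 1))" and F: "computable (\<lambda>e. rat_enc (F e))"
  shows "decidable (\<lambda>e. \<exists>a b. quotient_of (F e) = (int a, int b) \<and> P a b)"
proof -
  have code: "(\<exists>a b. quotient_of q = (int a, int b) \<and> P a b) \<longleftrightarrow>
      (\<exists>a\<le>rat_enc q. \<exists>b\<le>rat_enc q.
        2 * rat_enc q = (2 * a + 2 * b) * (2 * a + 2 * b + 1) + 2 * (2 * a) \<and> P a b)" for q
  proof -
    have "quotient_of q = (int a, int b) \<longleftrightarrow>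
        2 * rat_enc q = (2 * a + 2 * b) * (2 * a + 2 * b + 1) + 2 * (2 * a)" for a b
      unfolding quotient_of_eq_iff_rat_enc double_prod_encode[symmetric] by linarith
    moreover have "a \<le> rat_enc q \<and> b \<le> rat_enc q" if "quotient_of q = (int a, int b)" for a b
      using that le_prod_encode_1[of "2 * a" "2 * b"] le_prod_encode_2[of "2 * b" "2 * a"]
      unfolding quotient_of_eq_iff_rat_enc by linarith
    ultimately show ?thesis by blast
  qed
  have search: "decidable (\<lambda>e. \<exists>a\<le>e 0. \<exists>b\<le>e 0.
      2 * e 0 = (2 * a + 2 * b) * (2 * a + 2 * b + 1) + 2 * (2 * a) \<and> P a b)"
    by (intro computable_intros
        computable_comp3[where F = "\<lambda>a b _. of_bool (P a b)" and C = "\<lambda>_. 0", OF P])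
  from computable_comp1[OF search F] show ?thesis unfolding code .
qed

lemma fraction_less_iff_quotient_of:
  assumes "n > 0"
  shows "of_nat m / of_nat n < q \<longleftrightarrow> (\<exists>a b. quotient_of q = (int a, int b) \<and> m * b < n * a)" (is ?above)
    and "q < of_nat m / of_nat n \<longleftrightarrow> \<not> (\<exists>a b. quotient_of q = (int a, int b) \<and> m * b \<le> n * a)" (is ?below)
proof -
  obtain p d where pd: "quotient_of q = (p, int d)" "d > 0"
    by (metis quotient_of_denom_pos surj_pair zero_less_imp_eq_int)
  then have q: "q = of_int p / of_nat d"
    using quotient_of_div by fastforce
  have "of_nat m / of_nat n < q \<longleftrightarrow> of_int (int (m * d)) < (of_int (int n * p) :: rat)"
    and "q < of_nat m / of_nat n \<longleftrightarrow> of_int (int n * p) < (of_int (int (m * d)) :: rat)"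
    using assms pd(2) by (simp_all add: q field_simps)
  then have compare: "of_nat m / of_nat n < q \<longleftrightarrow> int (m * d) < int n * p"
    "q < of_nat m / of_nat n \<longleftrightarrow> int n * p < int (m * d)"
    unfolding of_int_less_iff by blast+
  have "?above \<and> ?below"
  proof (cases p rule: int_cases)
    case (nonneg a)
    show ?thesis
      unfolding compare nonneg of_nat_mult[symmetric] of_nat_less_iff using pd(1) nonneg by auto
  next
    case (neg a)
    then have "int n * p < int (m * d)"
      using assms mult_pos_neg[of "int n" p] by (simp add: order.strict_trans2)
    with neg show ?thesis
      unfolding compare using pd(1) by auto
  qed
  then show ?above and ?below by blast+
qed

lemma decidable_beyond:
  assumes "computable (\<lambda>e. rat_enc (F e))" "n > 0"
  shows "decidable (\<lambda>e. beyond (of_nat l / of_nat n) (of_nat h / of_nat n) k (F e))"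
proof (cases "even k")
  case True
  have "decidable (\<lambda>e. \<exists>a b. quotient_of (F e) = (int a, int b) \<and> h * b < n * a)"
    by (intro decidable_quotient_of computable_intros assms(1))
  then show ?thesis
    using True by (simp add: beyond_def fraction_less_iff_quotient_of(1)[OF assms(2)])
next
  case False
  have "decidable (\<lambda>e. \<not> (\<exists>a b. quotient_of (F e) = (int a, int b) \<and> l * b \<le> n * a))"
    by (intro decidable_not decidable_quotient_of computable_intros assms(1))
  then show ?thesis
    using False by (simp add: beyond_def fraction_less_iff_quotient_of(2)[OF assms(2)])
qed

lemma decidable_oscillates:
  assumes F: "computable (\<lambda>e. rat_enc (F (e 0) (e 1) (e 2)))" and "n > 0"
  shows "decidable (\<lambda>e. oscillates (of_nat l / of_nat n) (of_nat h / of_nat n) (F (e 0) (e 1)) k (e 2))"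
proof (induction k)
  case (Suc k)
  have "decidable (\<lambda>e. \<exists>t\<le>e 2. oscillates (of_nat l / of_nat n) (of_nat h / of_nat n) (F (e 0) (e 1)) k t \<and>
      beyond (of_nat l / of_nat n) (of_nat h / of_nat n) k (F (e 0) (e 1) t))"
    by (intro decidable_bex decidable_conj decidable_beyond computable_var \<open>n > 0\<close>
        computable_comp3[where F = "\<lambda>x y t. of_bool (oscillates _ _ (F x y) k t)", OF Suc]
        computable_comp3[where F = "\<lambda>x y t. rat_enc (F x y t)", OF F])
  then show ?case by simp
qed (simp add: computable_const)

section \<open>Density in squares and bands of pairs\<close>

text \<open>The density of \<open>X\<close> in \<open>A\<close> is at most \<open>K / C\<close>.\<close>

definition density_le :: "nat \<Rightarrow> nat \<Rightarrow> 'a set \<Rightarrow> 'a set \<Rightarrow> bool" where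
  "density_le C K X A \<longleftrightarrow> C * card (A \<inter> X) \<le> K * card A"

lemma density_le_subset:
  assumes "density_le C K Y A" "finite A" "A \<inter> X \<subseteq> Y"
  shows "density_le C K X A"
proof -
  have "card (A \<inter> X) \<le> card (A \<inter> Y)"
    using assms(2,3) by (intro card_mono) auto
  then show ?thesis
    using assms(1) mult_le_mono2[of _ _ C] unfolding density_le_def by (meson le_trans)
qed

lemma density_le_Un:
  assumes "density_le C K X A" "density_le C L Y A"
  shows "density_le C (K + L) (X \<union> Y) A"
proof -
  have "C * card (A \<inter> (X \<union> Y)) \<le> C * (card (A \<inter> X) + card (A \<inter> Y))"
    unfolding Int_Un_distrib by (intro mult_le_mono2 card_Un_le)
  also have "\<dots> \<le> K * card A + L * card A"
    using assms by (simp add: density_le_def distrib_left)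
  finally show ?thesis by (simp add: density_le_def distrib_right)
qed

lemma ex_fiber_density_le:
  assumes "finite A" "finite J" "J \<noteq> {}" "\<phi> ` A \<subseteq> J" "density_le C K X A"
  shows "\<exists>j\<in>J. density_le C K X {z \<in> A. \<phi> z = j}"
proof (rule ccontr)
  have card_fibers: "(\<Sum>j\<in>J. card {z \<in> B. \<phi> z = j}) = card B" if "B \<subseteq> A" for B
    using sum.group[of B J \<phi> "\<lambda>_. 1::nat"] assms(1,2,4) that by (auto dest: finite_subset)
  assume "\<not> (\<exists>j\<in>J. density_le C K X {z \<in> A. \<phi> z = j})"
  moreover have "{z \<in> A. \<phi> z = j} \<inter> X = {z \<in> A \<inter> X. \<phi> z = j}" for j by auto
  ultimately have "(\<Sum>j\<in>J. K * card {z \<in> A. \<phi> z = j}) < (\<Sum>j\<in>J. C * card {z \<in> A \<inter> X. \<phi> z = j})"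
    using assms(2,3) by (intro sum_strict_mono) (auto simp: density_le_def not_le)
  then have "K * card A < C * card (A \<inter> X)"
    by (simp only: sum_distrib_left[symmetric] card_fibers order_refl Int_lower1)
  then show False
    using assms(5) by (simp add: density_le_def)
qed

definition square :: "nat \<Rightarrow> nat \<Rightarrow> nat \<Rightarrow> (nat \<times> nat) set" where
  "square a b n = {a..<a + n} \<times> {b..<b + n}"

lemma finite_square [simp]: "finite (square a b n)"
  by (simp add: square_def)

lemma card_square [simp]: "card (square a b n) = n * n"
  by (simp add: square_def)

text \<open>A band is the union of the products of matched blocks of length \<open>D\<close>, where the \<open>i\<close>-th and the
  \<open>q\<close>-th block are matched if \<open>i + q\<close> is congruent to \<open>j\<close> modulo the number \<open>R\<close> of blocks.\<close>

definition band :: "nat \<Rightarrow> nat \<Rightarrow> nat \<Rightarrow> nat \<Rightarrow> nat \<Rightarrow> (nat \<times> nat) set" where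
  "band a b R D j = {(x, y) \<in> square a b (R * D). ((x - a) div D + (y - b) div D) mod R = j}"

definition partner :: "nat \<Rightarrow> nat \<Rightarrow> nat \<Rightarrow> nat" where
  "partner R j i = (j + R - i) mod R"

lemma partner_less: "R > 0 \<Longrightarrow> partner R j i < R"
  by (simp add: partner_def)

lemma add_mod_eq_iff_partner:
  assumes "i < R" "q < R" "j < R"
  shows "(i + q) mod R = j \<longleftrightarrow> q = partner R j i"
proof -
  have "(i + q) mod R = (if i + q < R then i + q else i + q - R)"
    using assms by (simp add: mod_if)
  moreover have "partner R j i = (if i \<le> j then j - i else j + R - i)"
    using assms by (auto simp: partner_def mod_if)
  ultimately show ?thesis using assms by auto
qed

lemma finite_band [simp]: "finite (band a b R D j)"
  by (rule finite_subset[of _ "square a b (R * D)"]) (auto simp: band_def)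

lemma band_swap: "(x, y) \<in> band a b R D j \<longleftrightarrow> (y, x) \<in> band b a R D j"
  by (auto simp: band_def square_def add.commute)

lemma mem_block_iff:
  fixes D :: nat
  assumes "D > 0" "q < R"
  shows "y \<in> {b + q * D..<b + q * D + D} \<longleftrightarrow> y \<in> {b..<b + R * D} \<and> (y - b) div D = q"
proof -
  have div_eq: "(y - b) div D = q \<longleftrightarrow> q * D \<le> y - b \<and> y - b < Suc q * D"
    unfolding less_eq_div_iff_mult_less_eq[OF assms(1), symmetric]
      div_less_iff_less_mult[OF assms(1), symmetric] by auto
  have "Suc q * D \<le> R * D" using assms(2) by (intro mult_le_mono1) simp
  then show ?thesis unfolding div_eq using assms(1) by auto
qed

lemma band_eq_Sigma:
  assumes "D > 0" "j < R"
  shows "band a b R D j = (SIGMA x:{a..<a + R * D}.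
    {b + partner R j ((x - a) div D) * D..<b + partner R j ((x - a) div D) * D + D})"
proof -
  have "y \<in> {b..<b + R * D} \<and> ((x - a) div D + (y - b) div D) mod R = j \<longleftrightarrow>
      y \<in> {b + partner R j ((x - a) div D) * D..<b + partner R j ((x - a) div D) * D + D}"
    if "x \<in> {a..<a + R * D}" for x y
  proof -
    have index: "(z - e) div D < R" if "z \<in> {e..<e + R * D}" for z e
      using that assms(1) by (simp add: div_less_iff_less_mult less_diff_conv2 add.commute)
    have "0 < R" using assms(2) by simp
    show ?thesis
      unfolding mem_block_iff[OF assms(1) partner_less[OF \<open>0 < R\<close>]]
      using add_mod_eq_iff_partner[OF index[OF that] index assms(2)] by blast
  qed
  then show ?thesis unfolding band_def square_def by blast
qed

lemma card_band: "D > 0 \<Longrightarrow> j < R \<Longrightarrow> card (band a b R D j) = R * D * D"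
  by (simp add: band_eq_Sigma)

lemma block_of_band:
  assumes "D > 0" "j < R" "i < R"
  shows "{(x, y) \<in> band a b R D j. (x - a) div D = i} = square (a + i * D) (b + partner R j i * D) D"
  unfolding band_eq_Sigma[OF assms(1,2)] square_def
  using mem_block_iff[OF assms(1,3), of _ a] by fastforce

lemma ex_band_density_le:
  assumes "R > 0" "density_le C K X (square a b (R * D))"
  shows "\<exists>j<R. density_le C K X (band a b R D j)"
proof -
  have "band a b R D j =
      {z \<in> square a b (R * D). (\<lambda>(x, y). ((x - a) div D + (y - b) div D) mod R) z = j}" for j
    by (auto simp: band_def)
  moreover have "\<exists>j\<in>{..<R}. density_le C K X
      {z \<in> square a b (R * D). (\<lambda>(x, y). ((x - a) div D + (y - b) div D) mod R) z = j}"
    using assms by (intro ex_fiber_density_le) auto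
  ultimately show ?thesis by auto
qed

lemma ex_block_density_le:
  assumes "R > 0" "density_le C K X (band a b R D j)"
  shows "\<exists>i<R. density_le C K X {(x, y) \<in> band a b R D j. (x - a) div D = i}"
proof -
  have "(x - a) div D < R" if "(x, y) \<in> band a b R D j" for x y
    using that by (cases "D = 0")
      (auto simp: band_def square_def div_less_iff_less_mult less_diff_conv2 add.commute)
  then have "\<exists>i\<in>{..<R}. density_le C K X {z \<in> band a b R D j. (\<lambda>(x, y). (x - a) div D) z = i}"
    using assms by (intro ex_fiber_density_le) auto
  moreover have "{z \<in> band a b R D j. (\<lambda>(x, y). (x - a) div D) z = i} =
      {(x, y) \<in> band a b R D j. (x - a) div D = i}" for i by auto
  ultimately show ?thesis by auto
qed

lemma computable_partner [computable_intros]: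
  assumes "computable R" "computable J" "computable I" "\<And>e. R e > 0"
  shows "computable (\<lambda>e. partner (R e) (J e) (I e))"
  unfolding partner_def by (intro computable_intros assms)

lemma decidable_band [computable_intros]:
  assumes "computable A" "computable B" "computable R" "computable D" "computable J"
    and "computable X" "computable Y" and "\<And>e. R e > 0" "\<And>e. D e > 0"
  shows "decidable (\<lambda>e. (X e, Y e) \<in> band (A e) (B e) (R e) (D e) (J e))"
proof -
  have "decidable (\<lambda>e. (A e \<le> X e \<and> X e < A e + R e * D e) \<and> (B e \<le> Y e \<and> Y e < B e + R e * D e) \<and>
      ((X e - A e) div D e + (Y e - B e) div D e) mod R e = J e)"
    by (intro computable_intros assms)
  then show ?thesis by (simp add: band_def square_def)
qed

section \<open>The information distance on squares and bands\<close>

context universal_machine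
begin

lemma Kp_interval_le:
  assumes a: "computable1 a" and M: "computable1 M"
  obtains C where "\<And>m x. x \<in> {a m..<a m + 2 ^ M m} \<Longrightarrow> Kp U (bl_dec x) \<le> m + M m + C"
proof -
  have "computable3 (\<lambda>m v y. a m + v)"
    by (intro computable_intros computable_comp1[OF a])
  then obtain C where C: "\<And>m v y. v < 2 ^ M m \<Longrightarrow> Kc U (bl_dec (a m + v)) (bl_dec y) \<le> m + M m + C"
    using Kc_upper_bound[OF M] by meson
  have "Kp U (bl_dec x) \<le> m + M m + C" if "x \<in> {a m..<a m + 2 ^ M m}" for m x
    using C[of "x - a m" m 0] that by (auto simp: Kp_def)
  then show thesis by (rule that)
qed

lemma density_le_Kc_less_square:
  assumes "c \<le> M"
  shows "density_le (2 ^ c) 1 {(x, y). Kc U (bl_dec y) (bl_dec x) < M - c} (square a b (2 ^ M))"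
    (is "density_le _ _ ?X ?A")
proof -
  let ?S = "SIGMA x:{a..<a + 2 ^ M}. {y. Kc U (bl_dec y) (bl_dec x) < M - c}"
  have "card (?A \<inter> ?X) \<le> card ?S"
    by (intro card_mono finite_SigmaI finite_Kc_less) (auto simp: square_def)
  also have "\<dots> \<le> 2 ^ M * 2 ^ (M - c)"
    using sum_bounded_above[where A = "{a..<a + 2 ^ M}", OF card_Kc_less]
    by (simp add: finite_Kc_less)
  finally have "2 ^ c * card (?A \<inter> ?X) \<le> 2 ^ c * (2 ^ M * 2 ^ (M - c))" by simp
  also have "\<dots> = 1 * card ?A"
    using assms by (simp add: power_add[symmetric])
  finally show ?thesis unfolding density_le_def .
qed

lemma eventually_most_NID_large_on_square:
  assumes a: "computable1 a" and b: "computable1 b" and M: "computable1 M" and M_ge: "\<And>m. 8 * m \<le> M m"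
  shows "\<forall>\<^sub>F m in sequentially.
    density_le (2 ^ c) 1 {(x, y). NID U (bl_dec x) (bl_dec y) \<le> 2/3} (square (a m) (b m) (2 ^ M m))"
proof -
  obtain Ca where Ca: "\<And>m x. x \<in> {a m..<a m + 2 ^ M m} \<Longrightarrow> Kp U (bl_dec x) \<le> m + M m + Ca"
    by (rule Kp_interval_le[OF a M]) blast
  obtain Cb where Cb: "\<And>m y. y \<in> {b m..<b m + 2 ^ M m} \<Longrightarrow> Kp U (bl_dec y) \<le> m + M m + Cb"
    by (rule Kp_interval_le[OF b M]) blast
  show ?thesis
  proof (rule eventually_sequentiallyI)
    fix m assume m: "3 * c + 2 * Ca + 2 * Cb + 1 \<le> m"
    have "Kc U (bl_dec y) (bl_dec x) < M m - c"
      if "(x, y) \<in> square (a m) (b m) (2 ^ M m)" "NID U (bl_dec x) (bl_dec y) \<le> 2/3" for x y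
    proof -
      have "3 * Kc U (bl_dec y) (bl_dec x) \<le> 2 * max (Kp U (bl_dec x)) (Kp U (bl_dec y))"
        using less_NID_iff[of 3 2 "bl_dec x" "bl_dec y"] that(2) by simp
      also have "\<dots> \<le> 2 * (m + M m + Ca + Cb)"
        using Ca[of x m] Cb[of y m] that(1) by (auto simp: square_def)
      also have "\<dots> < 3 * (M m - c)"
        using m M_ge[of m] by simp
      finally show ?thesis by simp
    qed
    moreover have "c \<le> M m" using m M_ge[of m] by linarith
    ultimately show "density_le (2 ^ c) 1 {(x, y). NID U (bl_dec x) (bl_dec y) \<le> 2/3}
        (square (a m) (b m) (2 ^ M m))"
      by (intro density_le_subset[OF density_le_Kc_less_square]) auto
  qed
qed

lemma Kc_band_le:
  assumes a: "computable1 a" and b: "computable1 b" and J: "computable1 J" and l: "computable1 l"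
    and R: "computable1 R" "\<And>m. R m > 0"
  obtains C where "\<And>m x y. J m < R m \<Longrightarrow> (x, y) \<in> band (a m) (b m) (R m) (2 ^ l m) (J m) \<Longrightarrow>
    Kc U (bl_dec x) (bl_dec y) \<le> m + l m + C"
proof -
  define h where "h m u y = a m + partner (R m) (J m) ((y - b m) div 2 ^ l m) * 2 ^ l m + u" for m u y
  have "computable3 h"
    unfolding h_def
    by (intro computable_intros computable_comp1[OF a] computable_comp1[OF b] computable_comp1[OF J]
        computable_comp1[OF l] computable_comp1[OF R(1)]) (simp_all add: R(2))
  then obtain C where C: "\<And>m u y. u < 2 ^ l m \<Longrightarrow> Kc U (bl_dec (h m u y)) (bl_dec y) \<le> m + l m + C"
    using Kc_upper_bound[OF l] by meson
  have "Kc U (bl_dec x) (bl_dec y) \<le> m + l m + C"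
    if "J m < R m" "(x, y) \<in> band (a m) (b m) (R m) (2 ^ l m) (J m)" for m x y
  proof -
    have "(y, x) \<in> band (b m) (a m) (R m) (2 ^ l m) (J m)"
      using that(2) by (rule band_swap[THEN iffD1])
    then have "x \<in> {h m 0 y..<h m 0 y + 2 ^ l m}"
      using that(1) by (simp add: band_eq_Sigma h_def)
    then have "x - h m 0 y < 2 ^ l m" "h m (x - h m 0 y) y = x"
      by (auto simp: h_def)
    then show ?thesis using C[of "x - h m 0 y" m y] by simp
  qed
  then show thesis by (rule that)
qed

lemma density_le_Kp_less_band:
  assumes "c \<le> r + l" "j < 2 ^ r"
  shows "density_le (2 ^ c) 1 {(x, y). Kp U (bl_dec x) < r + l - c} (band a b (2 ^ r) (2 ^ l) j)"
    (is "density_le _ _ ?X ?B")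
proof -
  let ?b = "\<lambda>x. b + partner (2 ^ r) j ((x - a) div 2 ^ l) * 2 ^ l"
  let ?S = "SIGMA x:{x. Kc U (bl_dec x) [] < r + l - c}. {?b x..<?b x + 2 ^ l}"
  have "?B \<inter> ?X \<subseteq> ?S"
    using assms(2) by (auto simp: band_eq_Sigma Kp_def)
  then have "card (?B \<inter> ?X) \<le> card ?S"
    by (intro card_mono finite_SigmaI finite_Kc_less) auto
  also have "\<dots> \<le> 2 ^ (r + l - c) * 2 ^ l"
    using card_Kc_less[of "[]" "r + l - c"] by (simp add: finite_Kc_less)
  finally have "2 ^ c * card (?B \<inter> ?X) \<le> 2 ^ c * (2 ^ (r + l - c) * 2 ^ l)" by simp
  also have "\<dots> = 2 ^ (r + l + l)"
    using assms(1) by (simp add: power_add[symmetric])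
  also have "\<dots> = 1 * card ?B"
    using assms(2) by (simp add: card_band power_add)
  finally show ?thesis unfolding density_le_def .
qed

lemma eventually_most_NID_small_on_band:
  assumes a: "computable1 a" and b: "computable1 b" and J: "computable1 J" and l: "computable1 l"
    and l_ge: "\<And>m. 8 * m \<le> l m" and J_less: "\<forall>\<^sub>F m in sequentially. J m < 2 ^ (7 * l m)"
  shows "\<forall>\<^sub>F m in sequentially. density_le (2 ^ c) 1 {(x, y). 1/3 \<le> NID U (bl_dec x) (bl_dec y)}
    (band (a m) (b m) (2 ^ (7 * l m)) (2 ^ l m) (J m))"
proof -
  have R: "computable1 (\<lambda>m. 2 ^ (7 * l m))" "\<And>m. 0 < (2::nat) ^ (7 * l m)"
    by (intro computable_intros l) simp
  let ?B = "\<lambda>m. band (a m) (b m) (2 ^ (7 * l m)) (2 ^ l m) (J m)"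
  obtain C1 where C1: "\<And>m x y. J m < 2 ^ (7 * l m) \<Longrightarrow> (x, y) \<in> ?B m \<Longrightarrow>
      Kc U (bl_dec x) (bl_dec y) \<le> m + l m + C1"
    by (rule Kc_band_le[OF a b J l R]) blast
  obtain C2 where C2: "\<And>m x y. J m < 2 ^ (7 * l m) \<Longrightarrow> (x, y) \<in> ?B m \<Longrightarrow>
      Kc U (bl_dec y) (bl_dec x) \<le> m + l m + C2"
    by (rule Kc_band_le[OF b a J l R]) (blast dest: band_swap[THEN iffD1])
  show ?thesis
    using J_less eventually_ge_at_top[of "c + 3 * C1 + 3 * C2 + 1"]
  proof eventually_elim
    case (elim m)
    have "Kp U (bl_dec x) < 7 * l m + l m - c"
      if "(x, y) \<in> ?B m" "1/3 \<le> NID U (bl_dec x) (bl_dec y)" for x y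
    proof -
      have "Kp U (bl_dec x) \<le> 3 * max (Kc U (bl_dec x) (bl_dec y)) (Kc U (bl_dec y) (bl_dec x))"
        using NID_less_iff[of 3 "bl_dec x" "bl_dec y" 1] that(2) by simp
      also have "\<dots> \<le> 3 * (m + l m + C1 + C2)"
        using C1[OF elim(1) that(1)] C2[OF elim(1) that(1)] by simp
      also have "\<dots> < 7 * l m + l m - c"
        using elim(2) l_ge[of m] by (simp add: distrib_left less_diff_conv)
      finally show ?thesis .
    qed
    moreover have "c \<le> 7 * l m + l m" using elim(2) l_ge[of m] by linarith
    ultimately show ?case
      using elim(1) by (intro density_le_subset[OF density_le_Kp_less_band]) auto
  qed
qed

end

section \<open>Oscillations of an approximation of NID\<close>

locale NID_approximation = universal_machine +
  fixes f :: "bool list \<Rightarrow> bool list \<Rightarrow> nat \<Rightarrow> rat"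
  assumes approximates: "approximates f (NID U)"
begin

abbreviation osc :: "nat \<Rightarrow> nat \<Rightarrow> nat \<Rightarrow> nat \<Rightarrow> bool" where
  "osc k x y \<equiv> oscillates (1/3) (2/3) (f (bl_dec x) (bl_dec y)) k"

definition unseen :: "nat \<Rightarrow> (nat \<times> nat) set" where
  "unseen k = {(x, y). \<forall>s. \<not> osc k x y s}"

lemma decidable_osc: "decidable (\<lambda>e. osc k (e 0) (e 1) (e 2))"
proof -
  obtain c where c: "\<And>x y s r. eval c [bl_enc x, bl_enc y, s] r \<longleftrightarrow> r = rat_enc (f x y s)"
    using approximates unfolding approximates_def computable_approx_def by blast
  have "computes c 3 (\<lambda>e. rat_enc (f (bl_dec (e 0)) (bl_dec (e 1)) (e 2)))"
    using c[of "bl_dec _" "bl_dec _"]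
    by (simp add: computes_def numeral_3_eq_3 numeral_2_eq_2)
  then have "computable (\<lambda>e. rat_enc (f (bl_dec (e 0)) (bl_dec (e 1)) (e 2)))"
    unfolding computable_def by blast
  then show ?thesis
    using decidable_oscillates[where F = "\<lambda>x y. f (bl_dec x) (bl_dec y)" and n = 3 and l = 1 and h = 2]
    by simp
qed

lemma unseen_Suc_subset:
  "unseen (Suc k) \<subseteq> unseen k \<union> {(x, y). \<not> beyond (1/3) (2/3) k (NID U (bl_dec x) (bl_dec y))}"
proof -
  have "\<exists>s. osc (Suc k) x y s"
    if "osc k x y s" "beyond (1/3) (2/3) k (NID U (bl_dec x) (bl_dec y))" for x y s
  proof -
    have "(\<lambda>t. real_of_rat (f (bl_dec x) (bl_dec y) t)) \<longlonglongrightarrow> real_of_rat (NID U (bl_dec x) (bl_dec y))"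
      using approximates by (simp add: approximates_def)
    from eventually_beyond[OF this, of "real_of_rat (1/3)" "real_of_rat (2/3)" k]
    have "\<forall>\<^sub>F t in sequentially. beyond (1/3) (2/3) k (f (bl_dec x) (bl_dec y) t)"
      using that(2) by (simp only: beyond_of_rat)
    then obtain t where "t \<ge> s" "beyond (1/3) (2/3) k (f (bl_dec x) (bl_dec y) t)"
      unfolding eventually_sequentially by (metis nat_le_linear)
    then have "osc (Suc k) x y t"
      using oscillates_mono[OF that(1)] by auto
    then show ?thesis ..
  qed
  then show ?thesis unfolding unseen_def by blast
qed

lemma density_le_unseen_Suc:
  assumes "density_le C K (unseen k) A" "finite A"
    and "density_le C 1 {(x, y). \<not> beyond (1/3) (2/3) k (NID U (bl_dec x) (bl_dec y))} A"
  shows "density_le C (Suc K) (unseen (Suc k)) A"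
  using density_le_subset[OF density_le_Un[OF assms(1,3)] assms(2)] unseen_Suc_subset by auto

lemma unseen_stabilizes:
  assumes "finite A"
  shows "\<exists>s. A \<inter> {(x, y). \<not> osc k x y s} = A \<inter> unseen k"
proof -
  have "\<forall>\<^sub>F s in sequentially. (\<not> osc k (fst z) (snd z) s) \<longleftrightarrow> z \<in> unseen k" for z
  proof (cases "z \<in> unseen k")
    case False
    then obtain s where s: "osc k (fst z) (snd z) s" by (auto simp: unseen_def split_beta)
    show ?thesis
      by (intro eventually_sequentiallyI[of s]) (simp add: False oscillates_mono[OF s])
  qed (simp add: unseen_def split_beta)
  then have "\<forall>\<^sub>F s in sequentially. \<forall>z\<in>A. (\<not> osc k (fst z) (snd z) s) \<longleftrightarrow> z \<in> unseen k"
    by (intro eventually_ball_finite assms ballI)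
  then obtain s where "\<forall>z\<in>A. (\<not> osc k (fst z) (snd z) s) \<longleftrightarrow> z \<in> unseen k"
    unfolding eventually_sequentially by blast
  then show ?thesis unfolding split_beta by blast
qed

lemma decidable_density_le_osc:
  assumes B: "decidable (\<lambda>e. (e 2, e 3) \<in> B (e 0) (e 1))" and N: "computable1 N"
    and bounded: "\<And>m j. B m j \<subseteq> {..<N m} \<times> {..<N m}"
  shows "decidable (\<lambda>e. density_le C K {(x, y). \<not> osc k x y (e 2)} (B (e 0) (e 1)))"
proof -
  note B' = computable_comp4[where F = "\<lambda>m j x y. of_bool ((x, y) \<in> B m j)", OF B]
    and osc' = computable_comp3[where F = "\<lambda>x y s. of_bool (osc k x y s)", OF decidable_osc]
  have bound: "x < N m \<and> y < N m" if "(x, y) \<in> B m j" for x y m j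
    using bounded[of m j] that by auto
  have "computable (\<lambda>e. card {(x, y). (x, y) \<in> B (e 0) (e 1) \<and> \<not> osc k x y (e 2)})"
    using bound by (intro computable_card_pairs[OF computable_comp1[OF N computable_var[of 0]]]
        computable_intros B' osc') blast
  moreover have "computable (\<lambda>e. card {(x, y). (x, y) \<in> B (e 0) (e 1)})"
    using bound by (intro computable_card_pairs[OF computable_comp1[OF N computable_var[of 0]]]
        computable_intros B') blast
  ultimately have "decidable (\<lambda>e. C * card {(x, y). (x, y) \<in> B (e 0) (e 1) \<and> \<not> osc k x y (e 2)} \<le>
      K * card {(x, y). (x, y) \<in> B (e 0) (e 1)})"
    by (intro computable_intros)
  moreover have "{(x, y). (x, y) \<in> A \<and> \<not> osc k x y s} = A \<inter> {(x, y). \<not> osc k x y s}"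
    "{(x, y). (x, y) \<in> A} = A" for A s by auto
  ultimately show ?thesis by (simp add: density_le_def)
qed

lemma computable_choice_density_le:
  assumes B: "decidable (\<lambda>e. (e 2, e 3) \<in> B (e 0) (e 1))" and N: "computable1 N" and R: "computable1 R"
    and bounded: "\<And>m j. B m j \<subseteq> {..<N m} \<times> {..<N m}"
    and ex: "\<forall>\<^sub>F m in sequentially. \<exists>j<R m. density_le C K (unseen k) (B m j)"
  obtains J where "computable1 J"
    "\<forall>\<^sub>F m in sequentially. J m < R m \<and> density_le C K (unseen k) (B m (J m))"
proof -
  have finite: "finite (B m j)" for m j
    using bounded by (rule finite_subset) simp
  define Q where "Q m j s \<longleftrightarrow> j < R m \<and> density_le C K {(x, y). \<not> osc k x y s} (B m j)" for m j s
  have "decidable (\<lambda>e. Q (e 0) (e 1) (e 2))"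
    unfolding Q_def
    by (intro computable_intros computable_comp1[OF R] decidable_density_le_osc[OF B N bounded])
  moreover have "\<forall>\<^sub>F m in sequentially. \<exists>j s. Q m j s"
    using ex
  proof eventually_elim
    case (elim m)
    then obtain j where j: "j < R m" "density_le C K (unseen k) (B m j)" by blast
    obtain s where "B m j \<inter> {(x, y). \<not> osc k x y s} = B m j \<inter> unseen k"
      using unseen_stabilizes[OF finite] by blast
    with j have "Q m j s" by (simp add: Q_def density_le_def)
    then show ?case by blast
  qed
  ultimately obtain J where J: "computable1 J" "\<forall>\<^sub>F m in sequentially. \<exists>s. Q m (J m) s"
    by (rule computable_choice)
  from J(2) have "\<forall>\<^sub>F m in sequentially. J m < R m \<and> density_le C K (unseen k) (B m (J m))"
  proof eventually_elim
    case (elim m)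
    then obtain s where s: "J m < R m" "density_le C K {(x, y). \<not> osc k x y s} (B m (J m))"
      by (auto simp: Q_def)
    have "B m (J m) \<inter> unseen k \<subseteq> {(x, y). \<not> osc k x y s}" by (auto simp: unseen_def)
    with s show ?case using density_le_subset[OF _ finite] by blast
  qed
  with J(1) show thesis by (rule that)
qed

lemma ex_computable_band_density_le:
  assumes a: "computable1 a" and b: "computable1 b" and R: "computable1 R" and D: "computable1 D"
    and pos: "\<And>m. R m > 0" "\<And>m. D m > 0"
    and square: "\<forall>\<^sub>F m in sequentially. density_le C K (unseen k) (square (a m) (b m) (R m * D m))"
  obtains J where "computable1 J" "\<forall>\<^sub>F m in sequentially.
    J m < R m \<and> density_le C K (unseen k) (band (a m) (b m) (R m) (D m) (J m))"
proof (rule computable_choice_density_le)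
  show "decidable (\<lambda>e. (e 2, e 3) \<in> band (a (e 0)) (b (e 0)) (R (e 0)) (D (e 0)) (e 1))"
    by (intro computable_intros pos a b R D)
  show "computable1 (\<lambda>m. a m + b m + R m * D m)"
    by (intro computable_intros a b R D)
  show "band (a m) (b m) (R m) (D m) j \<subseteq>
      {..<a m + b m + R m * D m} \<times> {..<a m + b m + R m * D m}" for m j
    by (auto simp: band_def square_def)
  show "\<forall>\<^sub>F m in sequentially. \<exists>j<R m. density_le C K (unseen k) (band (a m) (b m) (R m) (D m) j)"
    using square by eventually_elim (intro ex_band_density_le pos)
  show "computable1 R" by (rule R)
qed (rule that)

lemma ex_computable_block_density_le:
  assumes a: "computable1 a" and b: "computable1 b" and R: "computable1 R" and D: "computable1 D"
    and J: "computable1 J" and pos: "\<And>m. R m > 0" "\<And>m. D m > 0"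
    and band: "\<forall>\<^sub>F m in sequentially.
      J m < R m \<and> density_le C K (unseen k) (band (a m) (b m) (R m) (D m) (J m))"
  obtains a' b' where "computable1 a'" "computable1 b'"
    "\<forall>\<^sub>F m in sequentially. density_le C K (unseen k) (square (a' m) (b' m) (D m))"
proof -
  define block where
    "block m i = {(x, y) \<in> band (a m) (b m) (R m) (D m) (J m). (x - a m) div D m = i}" for m i
  obtain I where I: "computable1 I"
    "\<forall>\<^sub>F m in sequentially. I m < R m \<and> density_le C K (unseen k) (block m (I m))"
  proof (rule computable_choice_density_le)
    have "decidable (\<lambda>e. (e 2, e 3) \<in> band (a (e 0)) (b (e 0)) (R (e 0)) (D (e 0)) (J (e 0)) \<and>
        (e 2 - a (e 0)) div D (e 0) = e 1)"
      by (intro computable_intros pos a b R D J)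
    then show "decidable (\<lambda>e. (e 2, e 3) \<in> block (e 0) (e 1))"
      by (simp add: block_def)
    show "computable1 (\<lambda>m. a m + b m + R m * D m)"
      by (intro computable_intros a b R D)
    show "block m i \<subseteq> {..<a m + b m + R m * D m} \<times> {..<a m + b m + R m * D m}" for m i
      by (auto simp: block_def band_def square_def)
    show "\<forall>\<^sub>F m in sequentially. \<exists>i<R m. density_le C K (unseen k) (block m i)"
      using band unfolding block_def by eventually_elim (intro ex_block_density_le pos, blast)
    show "computable1 R" by (rule R)
  qed blast
  show thesis
  proof (rule that)
    show "computable1 (\<lambda>m. a m + I m * D m)"
      by (intro computable_intros a I(1) D)
    show "computable1 (\<lambda>m. b m + partner (R m) (J m) (I m) * D m)"
      by (intro computable_intros b R J I(1) D pos)
    show "\<forall>\<^sub>F m in sequentially. density_le C K (unseen k)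
        (square (a m + I m * D m) (b m + partner (R m) (J m) (I m) * D m) (D m))"
      using band I(2)
    proof eventually_elim
      case (elim m)
      then have "block m (I m) = square (a m + I m * D m) (b m + partner (R m) (J m) (I m) * D m) (D m)"
        unfolding block_def by (intro block_of_band pos) simp_all
      then show ?case using elim(2) by simp
    qed
  qed
qed

lemma ex_computable_subsquare_density_le_unseen:
  assumes a: "computable1 a" and b: "computable1 b" and l: "computable1 l"
    and l_ge: "\<And>m. 8 * m \<le> l m" and k: "even k"
    and few_unseen: "\<forall>\<^sub>F m in sequentially.
      density_le (2 ^ c) K (unseen k) (square (a m) (b m) (2 ^ (8 * l m)))"
  obtains a' b' where "computable1 a'" "computable1 b'" "\<forall>\<^sub>F m in sequentially.
    density_le (2 ^ c) (K + 2) (unseen (k + 2)) (square (a' m) (b' m) (2 ^ l m))"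
proof -
  have R: "computable1 (\<lambda>m. 2 ^ (7 * l m))" and D: "computable1 (\<lambda>m. 2 ^ l m)"
    by (intro computable_intros l)+
  have pos: "(0::nat) < 2 ^ (7 * l m)" "(0::nat) < 2 ^ l m" for m by simp_all
  have "8 * m \<le> 8 * l m" for m using l_ge[of m] by simp
  then have "\<forall>\<^sub>F m in sequentially. density_le (2 ^ c) 1
      {(x, y). NID U (bl_dec x) (bl_dec y) \<le> 2/3} (square (a m) (b m) (2 ^ (8 * l m)))"
    by (intro eventually_most_NID_large_on_square a b computable_intros l)
  with few_unseen have "\<forall>\<^sub>F m in sequentially. density_le (2 ^ c) (Suc K) (unseen (Suc k))
      (square (a m) (b m) (2 ^ (7 * l m) * 2 ^ l m))"
  proof eventually_elim
    case (elim m)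
    then have "density_le (2 ^ c) (Suc K) (unseen (Suc k)) (square (a m) (b m) (2 ^ (8 * l m)))"
      using k by (intro density_le_unseen_Suc) (simp_all add: beyond_def not_less)
    then show ?case by (simp add: power_add[symmetric])
  qed
  then obtain J where J: "computable1 J" and J_band: "\<forall>\<^sub>F m in sequentially. J m < 2 ^ (7 * l m) \<and>
      density_le (2 ^ c) (Suc K) (unseen (Suc k)) (band (a m) (b m) (2 ^ (7 * l m)) (2 ^ l m) (J m))"
    by (rule ex_computable_band_density_le[OF a b R D pos])
  from J_band have "\<forall>\<^sub>F m in sequentially. J m < 2 ^ (7 * l m)"
    by (auto elim: eventually_mono)
  then have "\<forall>\<^sub>F m in sequentially. density_le (2 ^ c) 1 {(x, y). 1/3 \<le> NID U (bl_dec x) (bl_dec y)}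
      (band (a m) (b m) (2 ^ (7 * l m)) (2 ^ l m) (J m))"
    by (rule eventually_most_NID_small_on_band[OF a b J l l_ge])
  with J_band have "\<forall>\<^sub>F m in sequentially. J m < 2 ^ (7 * l m) \<and>
      density_le (2 ^ c) (K + 2) (unseen (k + 2)) (band (a m) (b m) (2 ^ (7 * l m)) (2 ^ l m) (J m))"
  proof eventually_elim
    case (elim m)
    then show ?case
      using k density_le_unseen_Suc[of "2 ^ c" "Suc K" "Suc k"] by (simp add: beyond_def not_less)
  qed
  then show thesis
    by (rule ex_computable_block_density_le[OF a b R D J pos]) (rule that)
qed

lemma ex_computable_squares_density_le_unseen:
  "\<exists>a b. computable1 a \<and> computable1 b \<and> (\<forall>\<^sub>F m in sequentially.
    density_le (2 ^ c) (2 * k) (unseen (2 * k)) (square (a m) (b m) (2 ^ (8 ^ Suc d * m))))"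
proof (induction k arbitrary: d)
  case 0
  show ?case
    by (intro exI[of _ "\<lambda>_. 0"] conjI computable_const) (simp add: unseen_def density_le_def)
next
  case (Suc k)
  obtain a b where ab: "computable1 a" "computable1 b" and few_unseen: "\<forall>\<^sub>F m in sequentially.
      density_le (2 ^ c) (2 * k) (unseen (2 * k)) (square (a m) (b m) (2 ^ (8 * (8 ^ Suc d * m))))"
    using Suc[of "Suc d"] unfolding power_Suc[of 8 "Suc d"] mult.assoc by blast
  have l: "computable1 (\<lambda>m. 8 ^ Suc d * m)" by (intro computable_intros)
  have l_ge: "8 * m \<le> 8 ^ Suc d * m" for m :: nat by (intro mult_right_mono) simp_all
  have "even (2 * k)" by simp
  from ex_computable_subsquare_density_le_unseen[OF ab l l_ge this few_unseen] obtain a' b' where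
    "computable1 a'" "computable1 b'" "\<forall>\<^sub>F m in sequentially.
      density_le (2 ^ c) (2 * k + 2) (unseen (2 * k + 2)) (square (a' m) (b' m) (2 ^ (8 ^ Suc d * m)))"
    by blast
  then show ?case unfolding mult_Suc_right add.commute[of 2] by blast
qed

lemma osc_unbounded: "\<exists>x y s. osc (2 * k) x y s"
proof (rule ccontr)
  assume "\<not> (\<exists>x y s. osc (2 * k) x y s)"
  then have "unseen (2 * k) = UNIV" by (auto simp: unseen_def)
  moreover obtain a b m where
    "density_le (2 ^ (2 * k)) (2 * k) (unseen (2 * k)) (square a b (2 ^ (8 ^ Suc 0 * m)))"
    using ex_computable_squares_density_le_unseen[of "2 * k" k 0] by (auto simp: eventually_sequentially)
  ultimately have "2 ^ (2 * k) \<le> 2 * k"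
    unfolding density_le_def by simp
  then show False using less_exp[of "2 * k"] by linarith
qed

end

theorem mainTheorem13:
  fixes U :: machine and n :: nat
  assumes "universal_pf_machine U"
    and "n \<ge> 1"
  shows "\<not> in_Sigma n (NID U) \<and> \<not> in_Pi n (NID U)"
proof -
  have False if "approximates f (NID U)" and shape: "\<forall>x y. sig_shape n (f x y) \<or> pi_shape n (f x y)" for f
  proof -
    interpret NID_approximation U f
      using assms(1) that(1) by unfold_locales
    obtain x y s where "osc (2 * Suc n) x y s"
      using osc_unbounded by blast
    with shape show False
      using shape_oscillates_le[of n "f (bl_dec x) (bl_dec y)" "1/3" "2/3" "2 * Suc n" s] by simp
  qed
  then show ?thesis unfolding in_Sigma_def in_Pi_def by blast
qed

end
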